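(* Let $d,n\in\mathbb N$, $k\in[d]$, $\beta>0$. Let $\mathcal Z_k$ and, for $\mu\in[-k/d,k/d]^d$, $\mathcal D_{\mu,k}$ be the sparse data space and distribution defined in the context. Let $\pi=\mathsf{s\text{-}beta}_{[-k/d,k/d]}(\beta,\beta)^{\otimes d}$ be a prior over $\mu$ and set $$\phi_\mu(\theta,Z):=\Big\langle\theta,\ Z-\tfrac dk\mu\Big\rangle_{\mathrm{supp}(Z)}.$$ Then for every learning algorithm $\mathcal A_n:\mathcal Z_k^n\to\mathcal M_1(\mathbb R^d)$ (such that the output distribution has a finite mean for each sample) with sample $S_n=(Z_1,\dots,Z_n)$, $$\mathbb E_{\mu\sim\pi}\,\mathbb E_{S_n\sim\mathcal D_{\mu,k}^{\otimes n},\,\hat\theta\sim\mathcal A_n(S_n)}\left[\sum_{i=1}^n\phi_\mu(\hat\theta,Z_i)\right]=\frac{2\beta d}{k}\,\mathbb E_{\mu\sim\pi}\Big\langle\mu,\ \mathbb E_{S_n\sim\mathcal D_{\mu,k}^{\otimes n},\,\hat\theta\sim\mathcal A_n(S_n)}[\hat\theta]\Big\rangle.$$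
   Context: $\mathcal M_1(\mathcal R)$ is the set of probability measures on $\mathcal R$. For $x\in\mathbb R^d$, $\mathrm{supp}(x)$ is its set of nonzero coordinates and $\|x\|_0=|\mathrm{supp}(x)|$. For $R\subseteq[d]$, $\langle x,y\rangle_R=\sum_{i\in R}x^iy^i$, where superscripts denote coordinates. Sparse distributions: $\mathcal Z_k=\{z\in\{0,\pm1\}^d:\|z\|_0=k\}$. For $\mu\in[-k/d,k/d]^d$, $\mathcal D_{\mu,k}$ is the distribution on $\mathcal Z_k$ with mass function $\mathcal D_{\mu,k}(z)=\mathbb E_{J}[P_{\mu,k,J}(z)]$, where $J$ is uniform over the $k$-element subsets of $[d]$ and $P_{\mu,k,J}(z)=\mathbb 1(\mathrm{supp}(z)=J)\prod_{j\in J}\frac{1+(d/k)\mu^jz^j}{2}$. Rescaled symmetric beta distribution: for $\beta>0,\gamma\in(0,1]$, $\mathsf{s\text{-}beta}_{[-\gamma,\gamma]}(\beta,\beta)$ is the distribution on $[-\gamma,\gamma]$ with density $\frac1{\gamma B(\beta)}\big(1-(x/\gamma)^2\big)^{\beta-1}$, where $B(\beta)=2^{2\beta-1}\Gamma(\beta)^2/\Gamma(2\beta)$. *)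

theory Defs
  imports "HOL-Probability.Probability"
begin

definition supp :: "real ^ 'd \<Rightarrow> 'd set" where
  "supp x = {i. x $ i \<noteq> 0}"

definition inner_on :: "'d set \<Rightarrow> real ^ 'd \<Rightarrow> real ^ 'd \<Rightarrow> real" where
  "inner_on R x y = (\<Sum>i\<in>R. x $ i * y $ i)"

definition sparse_space :: "nat \<Rightarrow> (real ^ 'd) set" where
  "sparse_space k = {z. (\<forall>i. z $ i \<in> {0, 1, -1}) \<and> card (supp z) = k}"

definition param_box :: "nat \<Rightarrow> (real ^ 'd) set" where
  "param_box k = {\<mu>. \<forall>i. \<mu> $ i \<in> {- (real k / real CARD('d)) .. real k / real CARD('d)}}"

definition cond_mass :: "real ^ 'd \<Rightarrow> nat \<Rightarrow> 'd set \<Rightarrow> real ^ 'd \<Rightarrow> real" where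
  "cond_mass \<mu> k J z =
     of_bool (supp z = J) *
     (\<Prod>j\<in>J. (1 + (real CARD('d) / real k) * \<mu> $ j * z $ j) / 2)"

definition sparse_mass :: "real ^ 'd \<Rightarrow> nat \<Rightarrow> real ^ 'd \<Rightarrow> real" where
  "sparse_mass \<mu> k z =
     measure_pmf.expectation (pmf_of_set {J. card J = k}) (\<lambda>J. cond_mass \<mu> k J z)"

text \<open>The mass function lives on the sparse data space; it is extended by zero to the whole
  ambient space.  For parameters outside \<open>param_box k\<close> it need not be a mass function
  and the value of \<open>sparse_pmf\<close> is meaningless; see \<open>pmf_sparse_pmf\<close> below.\<close>

definition sparse_pmf :: "real ^ 'd \<Rightarrow> nat \<Rightarrow> (real ^ 'd) pmf" where
  "sparse_pmf \<mu> k =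
     embed_pmf (\<lambda>z. if z \<in> sparse_space k then sparse_mass \<mu> k z else 0)"

text \<open>Samples of size \<open>n\<close> are functions on \<open>{1..n}\<close>, with value \<open>undefined\<close> elsewhere
  (the convention of \<open>PiE\<close>).\<close>

definition sample_space :: "nat \<Rightarrow> nat \<Rightarrow> (nat \<Rightarrow> real ^ 'd) set" where
  "sample_space n k = {1..n} \<rightarrow>\<^sub>E sparse_space k"

definition sample_pmf :: "nat \<Rightarrow> real ^ 'd \<Rightarrow> nat \<Rightarrow> (nat \<Rightarrow> real ^ 'd) pmf" where
  "sample_pmf n \<mu> k = Pi_pmf {1..n} undefined (\<lambda>_. sparse_pmf \<mu> k)"

definition sbeta_const :: "real \<Rightarrow> real" where
  "sbeta_const \<beta> = 2 powr (2 * \<beta> - 1) * (Gamma \<beta>)\<^sup>2 / Gamma (2 * \<beta>)"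

text \<open>The underlying space of this measure is the interval, not the whole real line; likewise the
  underlying space of \<open>prior\<close> is \<open>param_box k\<close>.  Hence expectations under the prior
  never look at parameters for which \<open>sparse_pmf\<close> is meaningless.\<close>

definition sbeta :: "real \<Rightarrow> real \<Rightarrow> real measure" where
  "sbeta \<gamma> \<beta> =
     density (restrict_space lborel {-\<gamma>..\<gamma>})
       (\<lambda>x. ennreal (1 / (\<gamma> * sbeta_const \<beta>) * (1 - (x / \<gamma>)\<^sup>2) powr (\<beta> - 1)))"

definition prior :: "nat \<Rightarrow> real \<Rightarrow> (real ^ 'd) measure" where
  "prior k \<beta> =
     distr (PiM (UNIV :: 'd set) (\<lambda>_. sbeta (real k / real CARD('d)) \<beta>))
       (restrict_space borel (param_box k)) (\<lambda>m. \<chi> i. m i)"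

definition phi :: "nat \<Rightarrow> real ^ 'd \<Rightarrow> real ^ 'd \<Rightarrow> real ^ 'd \<Rightarrow> real" where
  "phi k \<mu> \<theta> Z = inner_on (supp Z) \<theta> (Z - (real CARD('d) / real k) *\<^sub>R \<mu>)"

text \<open>The sample space is finite, so a learning algorithm (a Markov kernel) carries no
  measurability condition in its input.\<close>

definition learning_algorithm ::
    "nat \<Rightarrow> nat \<Rightarrow> ((nat \<Rightarrow> real ^ 'd) \<Rightarrow> (real ^ 'd) measure) \<Rightarrow> bool" where
  "learning_algorithm n k A \<longleftrightarrow> (\<forall>S \<in> sample_space n k. A S \<in> space (prob_algebra borel))"

lemma finite_sparse_space: "finite (sparse_space k :: (real ^ 'd) set)"
proof -
  have "(sparse_space k :: (real ^ 'd) set)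
      \<subseteq> (\<lambda>f. \<chi> i. f i) ` (UNIV \<rightarrow>\<^sub>E {0, 1, -1})"
  proof
    fix z :: "real ^ 'd" assume "z \<in> sparse_space k"
    then have "(\<lambda>i. z $ i) \<in> UNIV \<rightarrow>\<^sub>E {0, 1, -1}"
      by (auto simp: sparse_space_def)
    moreover have "z = (\<chi> i. z $ i)" by simp
    ultimately show "z \<in> (\<lambda>f. \<chi> i. f i) ` (UNIV \<rightarrow>\<^sub>E {0, 1, -1})" by blast
  qed
  then show ?thesis by (rule finite_subset) (intro finite_imageI finite_PiE; simp)
qed

lemma sum_cond_mass:
  fixes \<mu> :: "real ^ 'd"
  assumes "card J = k"
  shows "(\<Sum>z\<in>sparse_space k. cond_mass \<mu> k J z) = 1"
proof -
  define c where "c = real CARD('d) / real k"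
  define f where "f j s = (1 + c * \<mu> $ j * s) / 2" for j s
  let ?E = "J \<rightarrow>\<^sub>E {1, -1 :: real}"
  let ?h = "\<lambda>g. \<chi> i. if i \<in> J then g i else (0::real)"
  have nz: "g i \<noteq> 0" if "g \<in> ?E" "i \<in> J" for g i
    using PiE_mem[OF that] by fastforce
  have supp: "supp (?h g) = J" if "g \<in> ?E" for g
    using nz[OF that] by (auto simp: supp_def)
  have "(\<Sum>z\<in>sparse_space k. cond_mass \<mu> k J z)
      = (\<Sum>z\<in>{z \<in> sparse_space k. supp z = J}. \<Prod>j\<in>J. f j (z $ j))"
    by (rule sum.mono_neutral_cong_right)
       (auto simp: finite_sparse_space cond_mass_def f_def c_def)
  also have "\<dots> = (\<Sum>g\<in>?E. \<Prod>j\<in>J. f j (g j))"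
  proof (rule sum.reindex_bij_witness[where i = ?h and j = "\<lambda>z. restrict (\<lambda>i. z $ i) J"])
    fix z :: "real ^ 'd" assume z: "z \<in> {z \<in> sparse_space k. supp z = J}"
    then show "?h (restrict (\<lambda>i. z $ i) J) = z"
      by (auto simp: supp_def vec_eq_iff)
    show "restrict (\<lambda>i. z $ i) J \<in> ?E"
    proof (rule restrict_PiE_iff[THEN iffD2], rule ballI)
      fix i assume "i \<in> J"
      then have "z $ i \<noteq> 0" using z by (auto simp: supp_def)
      moreover have "z $ i \<in> {0, 1, -1}" using z by (simp add: sparse_space_def)
      ultimately show "z $ i \<in> {1, -1}" by blast
    qed
    show "(\<Prod>j\<in>J. f j (restrict (\<lambda>i. z $ i) J j)) = (\<Prod>j\<in>J. f j (z $ j))"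
      by (rule prod.cong) auto
  next
    fix g assume g: "g \<in> ?E"
    show "restrict (\<lambda>i. ?h g $ i) J = g"
    proof
      fix i show "restrict (\<lambda>i. ?h g $ i) J i = g i"
        using PiE_arb[OF g, of i] by (cases "i \<in> J") simp_all
    qed
    have "?h g $ i \<in> {0, 1, -1}" for i
      by (cases "i \<in> J") (use PiE_mem[OF g, of i] in simp_all)
    then show "?h g \<in> {z \<in> sparse_space k. supp z = J}"
      using supp[OF g] assms by (auto simp: sparse_space_def)
  qed
  also have "\<dots> = (\<Prod>j\<in>J. \<Sum>s\<in>{1, -1}. f j s)"
    by (rule prod_sum_PiE[symmetric]) auto
  also have "\<dots> = 1"
    by (rule prod.neutral) (simp add: f_def add_divide_distrib diff_divide_distrib)
  finally show ?thesis .
qed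

lemma pmf_sparse_pmf:
  fixes \<mu> :: "real ^ 'd"
  assumes k: "k \<in> {1..CARD('d)}" and \<mu>: "\<mu> \<in> param_box k"
  shows "pmf (sparse_pmf \<mu> k) z = (if z \<in> sparse_space k then sparse_mass \<mu> k z else 0)"
proof -
  define F where "F = {J :: 'd set. card J = k}"
  have F: "finite F" "F \<noteq> {}"
    using k obtain_subset_with_card_n[of k "UNIV :: 'd set"] by (auto simp: F_def)
  have mass: "sparse_mass \<mu> k z = (\<Sum>J\<in>F. cond_mass \<mu> k J z) / card F" for z
    using F by (simp add: sparse_mass_def F_def integral_pmf_of_set)
  have nonneg: "0 \<le> sparse_mass \<mu> k z" if z: "z \<in> sparse_space k" for z
  proof -
    have "0 \<le> 1 + real CARD('d) / real k * \<mu> $ j * z $ j" for j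
    proof -
      have "\<bar>\<mu> $ j\<bar> \<le> real k / real CARD('d)"
        using \<mu> by (auto simp: param_box_def abs_le_iff minus_le_iff)
      moreover have "\<bar>z $ j\<bar> \<le> 1"
      proof -
        have "z $ j \<in> {0, 1, -1}" using z by (simp add: sparse_space_def)
        then show ?thesis by auto
      qed
      ultimately have "\<bar>\<mu> $ j\<bar> * \<bar>z $ j\<bar> \<le> real k / real CARD('d) * 1"
        by (intro mult_mono) auto
      then have "real CARD('d) / real k * (\<bar>\<mu> $ j\<bar> * \<bar>z $ j\<bar>) \<le> 1"
        using k by (simp add: field_simps)
      then have "\<bar>real CARD('d) / real k * \<mu> $ j * z $ j\<bar> \<le> 1"
        by (simp add: abs_mult mult.assoc)
      then show ?thesis by linarith
    qed
    then show ?thesis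
      unfolding mass cond_mass_def
      by (intro divide_nonneg_nonneg sum_nonneg mult_nonneg_nonneg prod_nonneg) auto
  qed
  have "(\<Sum>z\<in>sparse_space k. sparse_mass \<mu> k z)
      = (\<Sum>J\<in>F. \<Sum>z\<in>sparse_space k. cond_mass \<mu> k J z) / card F"
    unfolding mass sum_divide_distrib[symmetric] by (subst sum.swap) simp
  also have "\<dots> = 1"
    using F sum_cond_mass[of _ k \<mu>] by (simp add: F_def)
  finally have sum1: "(\<Sum>z\<in>sparse_space k. sparse_mass \<mu> k z) = 1" .
  have "(\<integral>\<^sup>+z. ennreal (if z \<in> sparse_space k then sparse_mass \<mu> k z else 0)
          \<partial>count_space UNIV)
      = (\<Sum>z\<in>sparse_space k. ennreal (sparse_mass \<mu> k z))"
    by (subst nn_integral_count_space'[OF finite_sparse_space[of k]])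
       (auto intro!: sum.cong)
  also have "\<dots> = 1"
    using sum1 nonneg by (simp)
  finally have total: "(\<integral>\<^sup>+z. ennreal (if z \<in> sparse_space k then sparse_mass \<mu> k z else 0)
      \<partial>count_space UNIV) = 1" .
  show ?thesis
    unfolding sparse_pmf_def by (rule pmf_embed_pmf[OF _ total]) (simp add: nonneg)
qed

end

(* Fix a sample S. Its likelihood factorises over the coordinates; in coordinate j it is a product
   g of factors (1 + x * s) / 2 with x = (d / k) * mu_j and signs s = +-1. The identity
   (1 - x^2) * (s / 2) = (s - x) * (1 + x * s) / 2 gives (1 - x^2) g' = g * (sum of (s - x)), so the
   j-th part of phi is a derivative of the likelihood. Integrating by parts against the beta density,
   where -2 beta x (1 - x^2)^(beta - 1) is the derivative of (1 - x^2)^beta, yields the claim for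
   each S and j; then sum over S and j. *)
theory Submission
  imports Defs
begin

section \<open>The beta weight: derivative, continuity and integrability\<close>

lemma one_minus_square_pos:
  fixes x \<gamma> :: real
  assumes "\<bar>x\<bar> < \<gamma>"
  shows "0 < 1 - (x / \<gamma>)\<^sup>2"
proof -
  have "\<bar>x / \<gamma>\<bar> < 1" using assms by (auto simp: divide_less_eq)
  then show ?thesis by (simp add: abs_square_less_1)
qed

lemma one_minus_square_nonneg:
  fixes x \<gamma> :: real
  assumes "\<gamma> > 0" "x \<in> {-\<gamma>..\<gamma>}"
  shows "0 \<le> 1 - (x / \<gamma>)\<^sup>2"
proof -
  have "\<bar>x / \<gamma>\<bar> \<le> 1" using assms by (auto simp: divide_simps abs_if)
  then show ?thesis by (simp add: abs_square_le_1)
qed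

text \<open>Lowering the exponent from \<open>\<beta>\<close> to \<open>\<beta> - 1\<close> produces
  the unnormalised density times a multiple of \<open>x\<close>. The endpoints are excluded because
  the derivative blows up there when \<open>\<beta> < 1\<close>.\<close>

lemma sbeta_weight_antiderivative:
  fixes \<gamma> \<beta> :: real
  assumes "\<bar>x\<bar> < \<gamma>"
  shows "((\<lambda>x. (1 - (x / \<gamma>)\<^sup>2) powr \<beta>) has_real_derivative
      (1 - (x / \<gamma>)\<^sup>2) powr (\<beta> - 1) * (- (2 * \<beta> * x / \<gamma>\<^sup>2))) (at x)"
proof -
  show ?thesis
    using one_minus_square_pos[OF assms] assms
    by (auto intro!: derivative_eq_intros simp: field_simps power2_eq_square)
qed

text \<open>The endpoints, where the base is 0, are included since the exponent is positive.
  Together with the derivative in the interior this suffices for the fundamental theorem of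
  calculus.\<close>

lemma continuous_on_sbeta_weight:
  fixes \<gamma> \<beta> :: real
  assumes "\<beta> > 0" "\<gamma> > 0"
  shows "continuous_on {-\<gamma>..\<gamma>} (\<lambda>x. (1 - (x / \<gamma>)\<^sup>2) powr \<beta>)"
proof -
  show ?thesis
    using assms one_minus_square_nonneg[of \<gamma>] by (intro continuous_on_powr' continuous_intros) auto
qed

text \<open>Absolute integrability refers to the completion of \<open>lborel\<close>; for Borel
  functions completing changes nothing.\<close>

lemma set_integrable_lborel_iff:
  fixes f :: "real \<Rightarrow> real"
  assumes "f \<in> borel_measurable borel" "A \<in> sets borel"
  shows "set_integrable lborel A f \<longleftrightarrow> f absolutely_integrable_on A"
  unfolding set_integrable_def using assms by (subst integrable_completion) auto

text \<open>With \<open>w\<close> the weight, \<open>x * w x\<close> is integrable as a derivative of constant sign on each half of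
  the interval, and \<open>w x = (x / \<gamma>)\<^sup>2 * w x + (1 - (x / \<gamma>)\<^sup>2) powr \<beta>\<close>.\<close>

lemma set_integrable_sbeta_weight:
  fixes \<gamma> \<beta> :: real
  assumes \<beta>: "\<beta> > 0" and \<gamma>: "\<gamma> > 0"
  shows "set_integrable lborel {-\<gamma>..\<gamma>} (\<lambda>x. (1 - (x / \<gamma>)\<^sup>2) powr (\<beta> - 1))"
proof -
  define w where "w x = (1 - (x / \<gamma>)\<^sup>2) powr (\<beta> - 1)" for x
  have [measurable]: "w \<in> borel_measurable borel" unfolding w_def by measurable
  \<comment> \<open>The constant cancels the factor \<open>-2 * \<beta> / \<gamma>\<^sup>2\<close>
    of the derivative; the sign \<open>s\<close> is chosen below to make \<open>s * x\<close>
    nonnegative.\<close>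
  define F where "F s x = - (s * \<gamma>\<^sup>2 / (2 * \<beta>)) * (1 - (x / \<gamma>)\<^sup>2) powr \<beta>" for s x :: real
  have F': "(F s has_real_derivative w x * (s * x)) (at x)" if "\<bar>x\<bar> < \<gamma>" for s x
    unfolding F_def w_def
    by (rule DERIV_cong[OF DERIV_cmult[OF sbeta_weight_antiderivative[OF that]]])
      (use \<beta> \<gamma> in simp)
  have cF: "continuous_on {-\<gamma>..\<gamma>} (F s)" for s
    unfolding F_def by (intro continuous_intros continuous_on_sbeta_weight assms)
  have half: "set_integrable lborel {a..b} (\<lambda>x. w x * (s * x))"
    if ab: "{a..b} \<subseteq> {-\<gamma>..\<gamma>}" "a \<le> b" and sx: "\<And>x. x \<in> {a..b} \<Longrightarrow> 0 \<le> s * x" for a b s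
  proof -
    have ab': "- \<gamma> \<le> a" "b \<le> \<gamma>" using ab by auto
    have "((\<lambda>x. w x * (s * x)) has_integral F s b - F s a) {a..b}"
      using ab ab' by (intro fundamental_theorem_of_calculus_interior)
        (auto simp: has_real_derivative_iff_has_vector_derivative[symmetric]
          intro!: F' continuous_on_subset[OF cF])
    \<comment> \<open>The fundamental theorem yields only a gauge integral; nonnegativity of the
      integrand makes it absolute.\<close>
    then have "(\<lambda>x. w x * (s * x)) absolutely_integrable_on {a..b}"
      using sx by (intro nonnegative_absolutely_integrable_1)
        (auto simp: has_integral_integrable_integral w_def)
    then show ?thesis by (subst set_integrable_lborel_iff) auto
  qed
  have abs_weight: "set_integrable lborel {-\<gamma>..\<gamma>} (\<lambda>x. w x * x)"
  proof -
    \<comment> \<open>Here \<open>x \<le> 0\<close>, so \<open>s = -1\<close> is used and the sign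
      is undone outside.\<close>
    have "set_integrable lborel {-\<gamma>..0} (\<lambda>x. (-1) * (w x * ((-1) * x)))"
      by (intro set_integrable_mult_right half) (use \<gamma> in auto)
    then have "set_integrable lborel {-\<gamma>..0} (\<lambda>x. w x * x)" by simp
    moreover have "set_integrable lborel {0..\<gamma>} (\<lambda>x. w x * (1 * x))"
      by (intro half) (use \<gamma> in auto)
    ultimately have "set_integrable lborel ({-\<gamma>..0} \<union> {0..\<gamma>}) (\<lambda>x. w x * x)"
      by (intro set_integrable_Un) auto
    moreover have "{-\<gamma>..0} \<union> {0..\<gamma>} = {-\<gamma>..\<gamma>}" using \<gamma> by auto
    ultimately show ?thesis by simp
  qed
  have "set_integrable lborel {-\<gamma>..\<gamma>} (\<lambda>x. (x / \<gamma>\<^sup>2) * (w x * x))"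
  proof (rule set_integrable_bound[OF set_integrable_mult_right[OF abs_weight, of "1 / \<gamma>"]])
    show "set_borel_measurable lborel {-\<gamma>..\<gamma>} (\<lambda>x. (x / \<gamma>\<^sup>2) * (w x * x))"
      unfolding set_borel_measurable_def by measurable
    show "AE x in lborel. x \<in> {-\<gamma>..\<gamma>} \<longrightarrow>
        norm (x / \<gamma>\<^sup>2 * (w x * x)) \<le> norm (1 / \<gamma> * (w x * x))"
    proof (intro AE_I2 impI)
      fix x assume "x \<in> {-\<gamma>..\<gamma>}"
      then have "\<bar>x / \<gamma>\<^sup>2\<bar> \<le> \<bar>1 / \<gamma>\<bar>"
        using \<gamma> by (auto simp: divide_simps power2_eq_square abs_if)
      then show "norm (x / \<gamma>\<^sup>2 * (w x * x)) \<le> norm (1 / \<gamma> * (w x * x))"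
        unfolding real_norm_def abs_mult by (intro mult_right_mono) auto
    qed
  qed
  moreover have "set_integrable lborel {-\<gamma>..\<gamma>} (\<lambda>x. (1 - (x / \<gamma>)\<^sup>2) powr \<beta>)"
    by (rule borel_integrable_atLeastAtMost') (rule continuous_on_sbeta_weight[OF assms])
  ultimately have "set_integrable lborel {-\<gamma>..\<gamma>}
      (\<lambda>x. (x / \<gamma>\<^sup>2) * (w x * x) + (1 - (x / \<gamma>)\<^sup>2) powr \<beta>)"
    by (rule set_integral_add)
  moreover have "(x / \<gamma>\<^sup>2) * (w x * x) + (1 - (x / \<gamma>)\<^sup>2) powr \<beta> = w x"
    if "x \<in> {-\<gamma>..\<gamma>}" for x
  proof -
    \<comment> \<open>This includes the endpoints, since \<open>0 powr y = 0\<close> for every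
      \<open>y\<close>.\<close>
    have "(1 - (x / \<gamma>)\<^sup>2) powr \<beta> = (1 - (x / \<gamma>)\<^sup>2) * w x"
      using powr_mult_base[OF one_minus_square_nonneg[OF \<gamma> that], of "\<beta> - 1"] by (simp add: w_def)
    then show ?thesis by (simp add: power2_eq_square algebra_simps)
  qed
  ultimately show ?thesis
    unfolding w_def[symmetric] by (subst (asm) set_integrable_cong[OF refl refl]) auto
qed

section \<open>Integration against \<open>sbeta\<close>, up to integration by parts\<close>

lemma sbeta_const_nonneg: "\<beta> > 0 \<Longrightarrow> 0 \<le> sbeta_const \<beta>"
  by (simp add: sbeta_const_def Gamma_real_pos less_imp_le)

lemma sets_sbeta: "sets (sbeta \<gamma> \<beta>) = sets (restrict_space borel {-\<gamma>..\<gamma>})"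
  by (simp add: sbeta_def sets_restrict_space)

lemma space_sbeta: "space (sbeta \<gamma> \<beta>) = {-\<gamma>..\<gamma>}"
  by (simp add: sbeta_def space_restrict_space)

text \<open>Moves integrals from the interval, as a space of its own, to set integrals over
  \<open>lborel\<close>, where calculus applies.\<close>

lemma
  fixes f :: "real \<Rightarrow> real"
  assumes "\<beta> > 0" "\<gamma> > 0" and f [measurable]: "f \<in> borel_measurable borel"
  shows integral_sbeta: "integral\<^sup>L (sbeta \<gamma> \<beta>) f
      = 1 / (\<gamma> * sbeta_const \<beta>) * (LINT x:{-\<gamma>..\<gamma>}|lborel. (1 - (x / \<gamma>)\<^sup>2) powr (\<beta> - 1) * f x)"
      (is ?I)
    and integrable_sbeta: "set_integrable lborel {-\<gamma>..\<gamma>} (\<lambda>x. (1 - (x / \<gamma>)\<^sup>2) powr (\<beta> - 1) * f x)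
      \<Longrightarrow> integrable (sbeta \<gamma> \<beta>) f" (is "?P \<Longrightarrow> ?Q")
proof -
  let ?C = "1 / (\<gamma> * sbeta_const \<beta>)"
  let ?w = "\<lambda>x. (1 - (x / \<gamma>)\<^sup>2) powr (\<beta> - 1)"
  \<comment> \<open>The density is wrapped in \<open>ennreal\<close>, which truncates negative
    values to 0.\<close>
  have C: "0 \<le> ?C" using assms sbeta_const_nonneg by simp
  have m: "g \<in> borel_measurable (restrict_space lborel {-\<gamma>..\<gamma>})"
    if "g \<in> borel_measurable borel" for g :: "real \<Rightarrow> real"
    using that by (intro measurable_restrict_space1) simp
  have "integral\<^sup>L (sbeta \<gamma> \<beta>) f
      = integral\<^sup>L (restrict_space lborel {-\<gamma>..\<gamma>}) (\<lambda>x. (?C * ?w x) *\<^sub>R f x)"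
    unfolding sbeta_def using C by (intro integral_density m) auto
  also have "\<dots> = (LINT x:{-\<gamma>..\<gamma>}|lborel. (?C * ?w x) *\<^sub>R f x)"
    by (subst integral_restrict_space) (auto simp: set_lebesgue_integral_def)
  also have "\<dots> = (LINT x:{-\<gamma>..\<gamma>}|lborel. ?C * (?w x * f x))"
    by (simp add: mult.assoc)
  also have "\<dots> = ?C * (LINT x:{-\<gamma>..\<gamma>}|lborel. ?w x * f x)"
    by (rule set_integral_mult_right)
  finally show ?I .
  assume ?P
  then have "set_integrable lborel {-\<gamma>..\<gamma>} (\<lambda>x. ?C * (?w x * f x))"
    by (rule set_integrable_mult_right)
  then have "integrable (restrict_space lborel {-\<gamma>..\<gamma>}) (\<lambda>x. (?C * ?w x) *\<^sub>R f x)"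
    by (subst integrable_restrict_space) (auto simp: set_integrable_def mult.assoc)
  then show ?Q
    unfolding sbeta_def using C by (subst integrable_density) (auto intro!: m)
qed

text \<open>A continuous function is bounded on the compact interval, so a multiple of the weight
  dominates the product.\<close>

lemma set_integrable_sbeta_weight_mult:
  fixes f :: "real \<Rightarrow> real"
  assumes "\<beta> > 0" "\<gamma> > 0" and f: "continuous_on UNIV f"
  shows "set_integrable lborel {-\<gamma>..\<gamma>} (\<lambda>x. (1 - (x / \<gamma>)\<^sup>2) powr (\<beta> - 1) * f x)"
proof -
  have [measurable]: "f \<in> borel_measurable borel"
    using f by (rule borel_measurable_continuous_onI)
  have "compact (f ` {-\<gamma>..\<gamma>})"
    by (intro compact_continuous_image continuous_on_subset[OF f]) auto
  then obtain B where B: "\<And>x. x \<in> {-\<gamma>..\<gamma>} \<Longrightarrow> \<bar>f x\<bar> \<le> B"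
    using compact_imp_bounded bounded_iff by (metis image_eqI real_norm_def)
  show ?thesis
  proof (rule set_integrable_bound[OF set_integrable_mult_right[OF
        set_integrable_sbeta_weight[OF assms(1,2)], of B]])
    show "set_borel_measurable lborel {-\<gamma>..\<gamma>} (\<lambda>x. (1 - (x / \<gamma>)\<^sup>2) powr (\<beta> - 1) * f x)"
      unfolding set_borel_measurable_def by measurable
    show "AE x in lborel. x \<in> {-\<gamma>..\<gamma>} \<longrightarrow> norm ((1 - (x / \<gamma>)\<^sup>2) powr (\<beta> - 1) * f x)
        \<le> norm (B * (1 - (x / \<gamma>)\<^sup>2) powr (\<beta> - 1))"
    proof (intro AE_I2 impI)
      fix x assume "x \<in> {-\<gamma>..\<gamma>}"
      then have "\<bar>f x\<bar> \<le> \<bar>B\<bar>" using B by force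
      then have "(1 - (x / \<gamma>)\<^sup>2) powr (\<beta> - 1) * \<bar>f x\<bar> \<le> (1 - (x / \<gamma>)\<^sup>2) powr (\<beta> - 1) * \<bar>B\<bar>"
        by (intro mult_left_mono) auto
      then show "norm ((1 - (x / \<gamma>)\<^sup>2) powr (\<beta> - 1) * f x)
          \<le> norm (B * (1 - (x / \<gamma>)\<^sup>2) powr (\<beta> - 1))"
        by (simp add: abs_mult mult.commute)
    qed
  qed
qed

lemma integrable_sbeta_continuous:
  fixes f :: "real \<Rightarrow> real"
  assumes "\<beta> > 0" "\<gamma> > 0" "continuous_on UNIV f"
  shows "integrable (sbeta \<gamma> \<beta>) f"
  using assms by (intro integrable_sbeta set_integrable_sbeta_weight_mult borel_measurable_continuous_onI)

text \<open>Makes the factors of the prior sigma-finite, as Fubini requires.\<close>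

lemma finite_measure_sbeta:
  assumes "\<beta> > 0" "\<gamma> > 0"
  shows "finite_measure (sbeta \<gamma> \<beta>)"
proof -
  have "integrable (sbeta \<gamma> \<beta>) (\<lambda>_. 1 :: real)"
    using assms by (intro integrable_sbeta_continuous) auto
  then show ?thesis
    by (intro finite_measureI) (simp add: integrable_iff_bounded less_top[symmetric])
qed

text \<open>The boundary terms vanish because \<open>(1 - (x / \<gamma>)\<^sup>2) powr \<beta>\<close> does.\<close>

lemma sbeta_integration_by_parts:
  fixes g h :: "real \<Rightarrow> real"
  assumes \<beta>: "\<beta> > 0" and \<gamma>: "\<gamma> > 0"
    and g: "continuous_on UNIV g" and h: "continuous_on UNIV h"
    and deriv: "\<And>x. \<bar>x\<bar> < \<gamma> \<Longrightarrow>
      (g has_real_derivative g x * h x / (\<gamma> * (1 - (x / \<gamma>)\<^sup>2))) (at x)"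
  shows "(LINT x|sbeta \<gamma> \<beta>. g x * h x) = 2 * \<beta> / \<gamma> * (LINT x|sbeta \<gamma> \<beta>. g x * x)"
proof -
  define w where "w x = (1 - (x / \<gamma>)\<^sup>2) powr (\<beta> - 1)" for x
  \<comment> \<open>\<open>?f\<close> is the derivative of \<open>?F\<close>. The denominator in
    \<open>deriv\<close> cancels one power of \<open>1 - (x / \<gamma>)\<^sup>2\<close>, so both
    terms of the product rule carry the density weight \<open>w\<close>.\<close>
  let ?F = "\<lambda>x. (1 - (x / \<gamma>)\<^sup>2) powr \<beta> * g x"
  let ?f = "\<lambda>x. w x * (g x * h x / \<gamma> - 2 * \<beta> / \<gamma>\<^sup>2 * (g x * x))"
  have F': "(?F has_real_derivative ?f x) (at x)" if x: "\<bar>x\<bar> < \<gamma>" for x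
  proof -
    note pos = one_minus_square_pos[OF x]
    then have P: "(1 - (x / \<gamma>)\<^sup>2) powr \<beta> = (1 - (x / \<gamma>)\<^sup>2) * w x"
      using powr_mult_base[of "1 - (x / \<gamma>)\<^sup>2" "\<beta> - 1"] by (simp add: w_def)
    have "(1 - (x / \<gamma>)\<^sup>2) * w x * (g x * h x / (\<gamma> * (1 - (x / \<gamma>)\<^sup>2))) = w x * (g x * h x / \<gamma>)"
    proof -
      have "p * c * (q / (\<gamma> * p)) = c * (q / \<gamma>)" if "p > 0" for p c q :: real
        using that by simp
      then show ?thesis using pos .
    qed
    then show ?thesis
      by (intro DERIV_cong[OF DERIV_mult[OF sbeta_weight_antiderivative[OF x] deriv[OF x]]])
        (simp add: P w_def[symmetric] algebra_simps)
  qed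
  have "continuous_on {-\<gamma>..\<gamma>} ?F"
    by (intro continuous_on_mult continuous_on_sbeta_weight \<beta> \<gamma> continuous_on_subset[OF g]) auto
  moreover have "(?F has_vector_derivative ?f x) (at x)" if "x \<in> {-\<gamma><..<\<gamma>}" for x
    unfolding has_real_derivative_iff_has_vector_derivative[symmetric]
    using that by (intro F') auto
  ultimately have "(?f has_integral ?F \<gamma> - ?F (-\<gamma>)) {-\<gamma>..\<gamma>}"
    using \<gamma> by (intro fundamental_theorem_of_calculus_interior) simp_all
  then have "integral {-\<gamma>..\<gamma>} ?f = 0" using \<gamma> by (simp add: integral_unique)
  \<comment> \<open>Absolute integrability identifies the gauge integral with the Lebesgue
    integral.\<close>
  moreover have "set_integrable lborel {-\<gamma>..\<gamma>} ?f"
    unfolding w_def using \<gamma>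
    by (intro set_integrable_sbeta_weight_mult continuous_intros \<beta> \<gamma> g h) auto
  ultimately have 0: "(LINT x:{-\<gamma>..\<gamma>}|lborel. ?f x) = 0"
    by (simp add: set_borel_integral_eq_integral)
  note c = continuous_on_mult[OF g h] continuous_on_mult[OF g continuous_on_id]
  note i = c[THEN integrable_sbeta_continuous[OF \<beta> \<gamma>]]
  have "0 = (LINT x|sbeta \<gamma> \<beta>. g x * h x / \<gamma> - 2 * \<beta> / \<gamma>\<^sup>2 * (g x * x))"
  proof -
    have m: "(\<lambda>x. g x * h x / \<gamma> - 2 * \<beta> / \<gamma>\<^sup>2 * (g x * x)) \<in> borel_measurable borel"
      using \<gamma> by (intro borel_measurable_continuous_onI continuous_intros g h) auto
    show ?thesis using 0 unfolding integral_sbeta[OF \<beta> \<gamma> m] w_def by simp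
  qed
  also have "\<dots> = (LINT x|sbeta \<gamma> \<beta>. g x * h x) / \<gamma> - 2 * \<beta> / \<gamma>\<^sup>2 * (LINT x|sbeta \<gamma> \<beta>. g x * x)"
    using i by simp
  finally show ?thesis using \<gamma> by (simp add: field_simps power2_eq_square)
qed

section \<open>The likelihood of signs in one coordinate\<close>

text \<open>Each factor has logarithmic derivative \<open>(s i - x / \<gamma>) / (\<gamma> * (1 - (x
  / \<gamma>)\<^sup>2))\<close>, and logarithmic derivatives of a product add. The induction does
  this through the product rule.\<close>

lemma sign_likelihood_deriv:
  fixes s :: "'i \<Rightarrow> real" and \<gamma> x :: real
  assumes "finite I" "\<And>i. i \<in> I \<Longrightarrow> s i \<in> {1, -1}" "\<bar>x\<bar> < \<gamma>"
  shows "((\<lambda>x. \<Prod>i\<in>I. (1 + x / \<gamma> * s i) / 2) has_real_derivative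
      (\<Prod>i\<in>I. (1 + x / \<gamma> * s i) / 2) * (\<Sum>i\<in>I. s i - x / \<gamma>) / (\<gamma> * (1 - (x / \<gamma>)\<^sup>2))) (at x)"
  using assms(1,2)
proof (induction I)
  case empty
  then show ?case by simp
next
  case (insert j I)
  let ?D = "\<gamma> * (1 - (x / \<gamma>)\<^sup>2)"
  have D: "?D \<noteq> 0" using one_minus_square_pos[OF assms(3)] assms(3) by auto
  have "((\<lambda>x. (1 + x / \<gamma> * s j) / 2) has_real_derivative s j / (2 * \<gamma>)) (at x)"
    using assms(3) by (auto intro!: derivative_eq_intros)
  moreover have "s j / (2 * \<gamma>) = (1 + x / \<gamma> * s j) / 2 * (s j - x / \<gamma>) / ?D"
  proof -
    have "s j = 1 \<or> s j = -1" using insert.prems[of j] by auto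
    \<comment> \<open>As \<open>s j\<close> squares to 1, the two terms linear in
      \<open>x / \<gamma>\<close> cancel.\<close>
    then have "(1 + x / \<gamma> * s j) * (s j - x / \<gamma>) = s j * (1 - (x / \<gamma>)\<^sup>2)"
      by (elim disjE) (simp_all add: algebra_simps power2_eq_square)
    then have "(1 + x / \<gamma> * s j) / 2 * (s j - x / \<gamma>) / ?D = s j * (1 - (x / \<gamma>)\<^sup>2) / 2 / ?D"
      by simp
    also have "\<dots> = s j / (2 * \<gamma>)" using D by simp
    finally show ?thesis by simp
  qed
  ultimately have f: "((\<lambda>x. (1 + x / \<gamma> * s j) / 2) has_real_derivative
      (1 + x / \<gamma> * s j) / 2 * (s j - x / \<gamma>) / ?D) (at x)" by simp
  have IH: "((\<lambda>x. \<Prod>i\<in>I. (1 + x / \<gamma> * s i) / 2) has_real_derivative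
      (\<Prod>i\<in>I. (1 + x / \<gamma> * s i) / 2) * (\<Sum>i\<in>I. s i - x / \<gamma>) / ?D) (at x)"
    using insert by simp
  have *: "a * u / D * b + b * v / D * a = a * b * (u + v) / D" for a b u v D :: real
    by (simp add: algebra_simps add_divide_distrib)
  show ?case
    unfolding prod.insert[OF insert.hyps] sum.insert[OF insert.hyps]
    by (rule DERIV_cong[OF DERIV_mult[OF f IH]]) (rule *)
qed

text \<open>The one-coordinate identity: integration by parts with \<open>g\<close> the likelihood
  and \<open>h\<close> the sum of residuals.\<close>

lemma sbeta_sign_likelihood:
  fixes s :: "'i \<Rightarrow> real"
  assumes "\<beta> > 0" "\<gamma> > 0" "finite I" "\<And>i. i \<in> I \<Longrightarrow> s i \<in> {1, -1}"
  shows "(LINT x|sbeta \<gamma> \<beta>. (\<Prod>i\<in>I. (1 + x / \<gamma> * s i) / 2) * (\<Sum>i\<in>I. s i - x / \<gamma>))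
      = 2 * \<beta> / \<gamma> * (LINT x|sbeta \<gamma> \<beta>. (\<Prod>i\<in>I. (1 + x / \<gamma> * s i) / 2) * x)"
  using assms
  by (intro sbeta_integration_by_parts sign_likelihood_deriv continuous_intros) auto

section \<open>Product measures and the prior\<close>

text \<open>Absorbing \<open>u\<close> into the factor with index \<open>j\<close> leaves a pure
  product, to which Fubini applies.\<close>

lemma (in product_sigma_finite)
  fixes f :: "'i \<Rightarrow> 'a \<Rightarrow> real" and u :: "'a \<Rightarrow> real"
  assumes I: "finite I" "j \<in> I"
    and f: "\<And>i. i \<in> I \<Longrightarrow> integrable (M i) (f i)" and u: "integrable (M j) (\<lambda>x. f j x * u x)"
  shows integrable_PiM_prod_times: "integrable (PiM I M) (\<lambda>x. (\<Prod>i\<in>I. f i (x i)) * u (x j))"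
      (is ?P)
    and integral_PiM_prod_times: "(LINT x|PiM I M. (\<Prod>i\<in>I. f i (x i)) * u (x j))
      = (LINT x|M j. f j x * u x) * (\<Prod>i\<in>I - {j}. integral\<^sup>L (M i) (f i))" (is ?Q)
proof -
  let ?f = "\<lambda>i x. if i = j then f j x * u x else f i x"
  have eq: "(\<Prod>i\<in>I. f i (x i)) * u (x j) = (\<Prod>i\<in>I. ?f i (x i))" for x
    using I by (simp add: prod.remove[of I j] mult_ac)
  have i: "integrable (M i) (?f i)" if "i \<in> I" for i
    using f[OF that] u by (cases "i = j") auto
  show ?P unfolding eq by (rule product_integrable_prod[OF I(1) i])
  have "(LINT x|PiM I M. (\<Prod>i\<in>I. f i (x i)) * u (x j)) = (\<Prod>i\<in>I. integral\<^sup>L (M i) (?f i))"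
    unfolding eq by (rule product_integral_prod[OF I(1) i])
  also have "\<dots> = (LINT x|M j. f j x * u x) * (\<Prod>i\<in>I - {j}. integral\<^sup>L (M i) (f i))"
    using I by (simp add: prod.remove[of I j])
  finally show ?Q .
qed

lemma space_prior: "space (prior k \<beta>) = param_box k"
  by (simp add: prior_def space_restrict_space)

text \<open>Permits the change of variables in \<open>prior\<close>. The image lies in the box
  because the space of \<open>sbeta\<close> is the interval itself.\<close>

lemma measurable_vec_lambda_param_box:
  "(\<lambda>m. \<chi> i. m i) \<in> PiM (UNIV :: 'd::finite set) (\<lambda>_. sbeta (real k / real CARD('d)) \<beta>)
    \<rightarrow>\<^sub>M restrict_space borel (param_box k :: (real ^ 'd) set)"
proof (rule measurable_restrict_space2)
  show "(\<lambda>m. \<chi> i. m i) \<in> space (PiM (UNIV :: 'd set) (\<lambda>_. sbeta (real k / real CARD('d)) \<beta>))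
      \<rightarrow> (param_box k :: (real ^ 'd) set)"
    by (auto simp: space_PiM space_sbeta param_box_def PiE_def Pi_def)
  let ?M = "PiM (UNIV :: 'd set) (\<lambda>_. sbeta (real k / real CARD('d)) \<beta>)"
  have "(\<lambda>m. m i) \<in> borel_measurable ?M" for i :: 'd
  proof -
    have "(\<lambda>x. x) \<in> borel_measurable (sbeta (real k / real CARD('d)) \<beta>)"
      by (subst measurable_cong_sets[OF sets_sbeta refl]) (rule measurable_restrict_space1, simp)
    then show ?thesis
      by (rule measurable_compose[OF measurable_component_singleton[OF UNIV_I]])
  qed
  then show "(\<lambda>m. (\<chi> i. m i) :: real ^ 'd) \<in> borel_measurable ?M"
    by (subst borel_measurable_euclidean_space) (auto simp: Basis_vec_def inner_axis)
qed

lemma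
  fixes f :: "real ^ 'd::finite \<Rightarrow> real"
  assumes f: "continuous_on UNIV f"
  shows integral_prior: "integral\<^sup>L (prior k \<beta>) f
      = (LINT m|PiM UNIV (\<lambda>_. sbeta (real k / real CARD('d)) \<beta>). f (\<chi> i. m i))"
    and integrable_prior: "integrable (prior k \<beta>) f \<longleftrightarrow>
      integrable (PiM UNIV (\<lambda>_. sbeta (real k / real CARD('d)) \<beta>)) (\<lambda>m. f (\<chi> i. m i))"
proof -
  have m: "f \<in> borel_measurable (restrict_space borel (param_box k))"
    using f by (intro measurable_restrict_space1 borel_measurable_continuous_onI)
  show "integral\<^sup>L (prior k \<beta>) f
      = (LINT m|PiM UNIV (\<lambda>_. sbeta (real k / real CARD('d)) \<beta>). f (\<chi> i. m i))"
    unfolding prior_def by (rule integral_distr[OF measurable_vec_lambda_param_box m])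
  show "integrable (prior k \<beta>) f \<longleftrightarrow>
      integrable (PiM UNIV (\<lambda>_. sbeta (real k / real CARD('d)) \<beta>)) (\<lambda>m. f (\<chi> i. m i))"
    unfolding prior_def by (rule integrable_distr_eq[OF measurable_vec_lambda_param_box m])
qed

text \<open>Isolates coordinate \<open>j\<close>. The remaining product does not depend on
  \<open>u\<close>, so an identity between one-dimensional integrals with two choices of
  \<open>u\<close> lifts to the prior.\<close>

lemma
  fixes f :: "'d::finite \<Rightarrow> real \<Rightarrow> real"
  assumes k: "k \<in> {1..CARD('d)}" and \<beta>: "\<beta> > 0"
    and f: "\<And>j. continuous_on UNIV (f j)" and u: "continuous_on UNIV u"
  shows integrable_prior_prod_times:
      "integrable (prior k \<beta>) (\<lambda>\<mu> :: real ^ 'd. (\<Prod>l\<in>UNIV. f l (\<mu> $ l)) * u (\<mu> $ j))"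
    and integral_prior_prod_times:
      "(LINT \<mu>|prior k \<beta>. (\<Prod>l\<in>UNIV. f l (\<mu> $ l)) * u (\<mu> $ j))
      = (LINT x|sbeta (real k / real CARD('d)) \<beta>. f j x * u x)
        * (\<Prod>l\<in>UNIV - {j}. integral\<^sup>L (sbeta (real k / real CARD('d)) \<beta>) (f l))"
proof -
  let ?M = "sbeta (real k / real CARD('d)) \<beta>"
  have \<gamma>: "real k / real CARD('d) > 0" using k by simp
  interpret finite_measure ?M by (rule finite_measure_sbeta[OF \<beta> \<gamma>])
  interpret product_sigma_finite "\<lambda>_ :: 'd. ?M"
    by unfold_locales
  have c: "continuous_on UNIV (\<lambda>\<mu> :: real ^ 'd. (\<Prod>l\<in>UNIV. f l (\<mu> $ l)) * u (\<mu> $ j))"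
    by (intro continuous_intros continuous_on_compose2[OF f] continuous_on_compose2[OF u]) auto
  have i: "integrable ?M (f l)" "integrable ?M (\<lambda>x. f j x * u x)" for l
    by (intro integrable_sbeta_continuous \<beta> \<gamma> continuous_on_mult f u)+
  show "integrable (prior k \<beta>) (\<lambda>\<mu> :: real ^ 'd. (\<Prod>l\<in>UNIV. f l (\<mu> $ l)) * u (\<mu> $ j))"
    unfolding integrable_prior[OF c] by (simp add: integrable_PiM_prod_times i)
  show "(LINT \<mu>|prior k \<beta>. (\<Prod>l\<in>UNIV. f l (\<mu> $ l)) * u (\<mu> $ j))
      = (LINT x|?M. f j x * u x) * (\<Prod>l\<in>UNIV - {j}. integral\<^sup>L ?M (f l))"
    unfolding integral_prior[OF c] by (simp add: integral_PiM_prod_times i)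
qed

section \<open>The likelihood of a sample\<close>

text \<open>Only \<open>J = supp z\<close> contributes to the average over supports. The factor
  \<open>d / k\<close> becomes division by \<open>k / d\<close>, the half-length of the interval of
  \<open>sbeta\<close>.\<close>

lemma sparse_mass_eq:
  fixes \<mu> z :: "real ^ 'd"
  assumes k: "k \<in> {1..CARD('d)}" and z: "z \<in> sparse_space k"
  shows "sparse_mass \<mu> k z = (\<Prod>j\<in>supp z. (1 + \<mu> $ j / (real k / real CARD('d)) * z $ j) / 2)
      / card {J :: 'd set. card J = k}"
proof -
  define F where "F = {J :: 'd set. card J = k}"
  have F: "finite F" "F \<noteq> {}"
    using k obtain_subset_with_card_n[of k "UNIV :: 'd set"] by (auto simp: F_def)
  have "supp z \<in> F" using z by (simp add: sparse_space_def F_def)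
  have "sparse_mass \<mu> k z = (\<Sum>J\<in>F. cond_mass \<mu> k J z) / card F"
    using F by (simp add: sparse_mass_def F_def integral_pmf_of_set)
  also have "(\<Sum>J\<in>F. cond_mass \<mu> k J z) = (\<Sum>J\<in>{supp z}. cond_mass \<mu> k J z)"
    using F \<open>supp z \<in> F\<close> by (intro sum.mono_neutral_right) (auto simp: cond_mass_def)
  finally show ?thesis by (simp add: F_def cond_mass_def mult.commute)
qed

lemma finite_sample_space: "finite (sample_space n k :: (nat \<Rightarrow> real ^ 'd) set)"
  unfolding sample_space_def by (intro finite_PiE finite_sparse_space) auto

text \<open>Exchanging the products over examples and coordinates puts each coordinate of
  \<open>\<mu>\<close> into a factor of its own, matching the product form of the prior. Vector
  values of \<open>f\<close> are allowed for the mean of the output.\<close>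

lemma integral_sample_pmf:
  fixes f :: "(nat \<Rightarrow> real ^ 'd) \<Rightarrow> 'b::{banach, second_countable_topology}"
  assumes k: "k \<in> {1..CARD('d)}" and \<mu>: "\<mu> \<in> param_box k"
  shows "(LINT S|measure_pmf (sample_pmf n \<mu> k). f S) =
    (\<Sum>S\<in>sample_space n k. ((\<Prod>j\<in>UNIV. \<Prod>i\<in>{i\<in>{1..n}. j \<in> supp (S i)}.
        (1 + \<mu> $ j / (real k / real CARD('d)) * S i $ j) / 2)
      / card {J :: 'd set. card J = k} ^ n) *\<^sub>R f S)"
proof -
  have pmf: "pmf (sample_pmf n \<mu> k) S = (if \<forall>i. i \<notin> {1..n} \<longrightarrow> S i = undefined
      then \<Prod>i=1..n. pmf (sparse_pmf \<mu> k) (S i) else 0)" for S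
    unfolding sample_pmf_def by (rule pmf_Pi) simp
  have "set_pmf (sample_pmf n \<mu> k) \<subseteq> sample_space n k"
  proof
    fix S assume "S \<in> set_pmf (sample_pmf n \<mu> k)"
    then have "pmf (sample_pmf n \<mu> k) S \<noteq> 0" by (simp add: set_pmf_iff)
    then show "S \<in> sample_space n k"
      unfolding pmf pmf_sparse_pmf[OF k \<mu>] sample_space_def
      by (fastforce simp: PiE_iff extensional_def prod_zero_iff split: if_splits)
  qed
  then have "(LINT S|measure_pmf (sample_pmf n \<mu> k). f S)
      = (\<Sum>S\<in>sample_space n k. pmf (sample_pmf n \<mu> k) S *\<^sub>R f S)"
    by (intro integral_measure_pmf finite_sample_space) auto
  also have "\<dots> = (\<Sum>S\<in>sample_space n k. ((\<Prod>j\<in>UNIV. \<Prod>i\<in>{i\<in>{1..n}. j \<in> supp (S i)}.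
        (1 + \<mu> $ j / (real k / real CARD('d)) * S i $ j) / 2)
      / card {J :: 'd set. card J = k} ^ n) *\<^sub>R f S)"
  proof (intro sum.cong refl arg_cong2[of _ _ _ _ scaleR])
    fix S :: "nat \<Rightarrow> real ^ 'd" assume S: "S \<in> sample_space n k"
    have Si: "S i \<in> sparse_space k" if "i \<in> {1..n}" for i
      using S that by (auto simp: sample_space_def)
    have "\<forall>i. i \<notin> {1..n} \<longrightarrow> S i = undefined"
      using S by (auto simp: sample_space_def PiE_iff extensional_def)
    then have "pmf (sample_pmf n \<mu> k) S = (\<Prod>i=1..n. pmf (sparse_pmf \<mu> k) (S i))"
      unfolding pmf by simp
    also have "\<dots> = (\<Prod>i=1..n.
        (\<Prod>j\<in>supp (S i). (1 + \<mu> $ j / (real k / real CARD('d)) * S i $ j) / 2)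
          / card {J :: 'd set. card J = k})"
      by (intro prod.cong refl) (simp only: pmf_sparse_pmf[OF k \<mu>] sparse_mass_eq[OF k Si] Si if_True)
    \<comment> \<open>The support is written as \<open>UNIV\<close> restricted by a relation between
      \<open>i\<close> and \<open>j\<close>, the form in which the two products can be
      exchanged.\<close>
    also have "\<dots> = (\<Prod>i=1..n.
        \<Prod>j\<in>{j\<in>UNIV. j \<in> supp (S i)}. (1 + \<mu> $ j / (real k / real CARD('d)) * S i $ j) / 2)
          / card {J :: 'd set. card J = k} ^ n"
      by (simp only: prod_dividef prod_constant card_atLeastAtMost diff_Suc_1 UNIV_I simp_thms of_nat_power
          Collect_mem_eq)
    also have "(\<Prod>i=1..n.
        \<Prod>j\<in>{j\<in>UNIV. j \<in> supp (S i)}. (1 + \<mu> $ j / (real k / real CARD('d)) * S i $ j) / 2)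
        = (\<Prod>j\<in>UNIV. \<Prod>i\<in>{i\<in>{1..n}. j \<in> supp (S i)}.
            (1 + \<mu> $ j / (real k / real CARD('d)) * S i $ j) / 2)"
      by (rule prod.swap_restrict[where R = "\<lambda>i j. j \<in> supp (S i)"
            and g = "\<lambda>i j. (1 + \<mu> $ j / (real k / real CARD('d)) * S i $ j) / 2"]) auto
    finally show "pmf (sample_pmf n \<mu> k) S = (\<Prod>j\<in>UNIV. \<Prod>i\<in>{i\<in>{1..n}. j \<in> supp (S i)}.
        (1 + \<mu> $ j / (real k / real CARD('d)) * S i $ j) / 2)
      / card {J :: 'd set. card J = k} ^ n" .
  qed
  finally show ?thesis .
qed

text \<open>\<open>phi\<close> is linear in \<open>\<theta>\<close>, so the output distribution
  enters only through its mean; the sum is then regrouped by coordinate.\<close>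

lemma integral_sum_phi:
  fixes M :: "(real ^ 'd) measure" and n :: nat
  assumes "integrable M (\<lambda>\<theta>. \<theta>)"
  shows "(LINT \<theta>|M. (\<Sum>i=1..n. phi k \<mu> \<theta> (S i)))
      = (\<Sum>j\<in>UNIV. (LINT \<theta>|M. \<theta>) $ j * (\<Sum>i\<in>{i\<in>{1..n}. j \<in> supp (S i)}.
          S i $ j - \<mu> $ j / (real k / real CARD('d))))"
proof -
  have int: "integrable M (\<lambda>\<theta>. \<theta> $ j)" and eq: "(LINT \<theta>|M. \<theta> $ j) = (LINT \<theta>|M. \<theta>) $ j" for j
    using integrable_bounded_linear[OF bounded_linear_vec_nth assms]
      integral_bounded_linear[OF bounded_linear_vec_nth assms] by auto
  have "(\<Sum>i=1..n. phi k \<mu> \<theta> (S i)) = (\<Sum>j\<in>UNIV. \<theta> $ j * (\<Sum>i\<in>{i\<in>{1..n}. j \<in> supp (S i)}.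
          S i $ j - \<mu> $ j / (real k / real CARD('d))))" for \<theta>
  proof -
    have "(\<Sum>i=1..n. phi k \<mu> \<theta> (S i)) = (\<Sum>i=1..n. \<Sum>j\<in>{j\<in>UNIV. j \<in> supp (S i)}.
        \<theta> $ j * (S i $ j - \<mu> $ j / (real k / real CARD('d))))"
      by (simp add: phi_def inner_on_def mult.commute)
    also have "\<dots> = (\<Sum>j\<in>UNIV. \<Sum>i\<in>{i\<in>{1..n}. j \<in> supp (S i)}.
        \<theta> $ j * (S i $ j - \<mu> $ j / (real k / real CARD('d))))"
      by (rule sum.swap_restrict[where R = "\<lambda>i j. j \<in> supp (S i)"
            and g = "\<lambda>i j. \<theta> $ j * (S i $ j - \<mu> $ j / (real k / real CARD('d)))"]) auto
    finally show ?thesis by (simp only: sum_distrib_left)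
  qed
  then show ?thesis by (simp add: int eq)
qed

section \<open>Summation over samples and coordinates\<close>

theorem lemma3p8:
  fixes n k :: nat and \<beta> :: real
    and A :: "(nat \<Rightarrow> real ^ 'd) \<Rightarrow> (real ^ 'd) measure"
  assumes "k \<in> {1..CARD('d)}"
    and "\<beta> > 0"
    and "learning_algorithm n k A"
    and "\<And>S. S \<in> sample_space n k \<Longrightarrow> integrable (A S) (\<lambda>\<theta>. \<theta>)"
  shows "(\<integral>\<mu>. (\<integral>S. (\<integral>\<theta>. (\<Sum>i=1..n. phi k \<mu> \<theta> (S i)) \<partial>A S) \<partial>measure_pmf (sample_pmf n \<mu> k)) \<partial>prior k \<beta>)
       = 2 * \<beta> * real CARD('d) / real k *
         (\<integral>\<mu>. \<mu> \<bullet> (\<integral>S. (\<integral>\<theta>. \<theta> \<partial>A S) \<partial>measure_pmf (sample_pmf n \<mu> k)) \<partial>prior k \<beta>)"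
proof -
  note k = assms(1) and \<beta> = assms(2)
  define \<gamma> where "\<gamma> = real k / real CARD('d)"
  have \<gamma>: "\<gamma> > 0" using k by (simp add: \<gamma>_def)
  define m where "m S = (LINT \<theta>|A S. \<theta>)" for S
  \<comment> \<open>\<open>1 / C\<close> is the probability of any given sequence of
    \<open>n\<close> supports; it is free of \<open>\<mu>\<close>.\<close>
  define C where "C = real (card {J :: 'd set. card J = k}) ^ n"
  \<comment> \<open>\<open>I S j\<close> collects the examples that reveal coordinate
    \<open>j\<close>, \<open>g\<close> is their likelihood there and \<open>h\<close> their sum of
    residuals; \<open>L S \<mu> / C\<close> is the probability of \<open>S\<close>.\<close>
  define I where "I S j = {i\<in>{1..n}. j \<in> supp (S i)}" for S :: "nat \<Rightarrow> real ^ 'd" and j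
  define g where "g S j x = (\<Prod>i\<in>I S j. (1 + x / \<gamma> * S i $ j) / 2)" for S j x
  define h where "h S j x = (\<Sum>i\<in>I S j. S i $ j - x / \<gamma>)" for S j x
  define L where "L S \<mu> = (\<Prod>j\<in>UNIV. g S j (\<mu> $ j))" for S \<mu>
  have g: "continuous_on UNIV (g S j)" and h: "continuous_on UNIV (h S j)" for S j
    unfolding g_def h_def using \<gamma> by (intro continuous_intros; auto)+
  note int = integrable_prior_prod_times[OF k \<beta>, of "g S" for S, OF g, folded L_def]
  have key: "(LINT \<mu>|prior k \<beta>. L S \<mu> * h S j (\<mu> $ j))
      = 2 * \<beta> / \<gamma> * (LINT \<mu>|prior k \<beta>. L S \<mu> * \<mu> $ j)" if S: "S \<in> sample_space n k" for S j
  proof -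
    have "S i $ j \<in> {1, -1}" if "i \<in> I S j" for i
      using S that by (fastforce simp: I_def sample_space_def sparse_space_def supp_def PiE_iff)
    then have "(LINT x|sbeta \<gamma> \<beta>. g S j x * h S j x) = 2 * \<beta> / \<gamma> * (LINT x|sbeta \<gamma> \<beta>. g S j x * x)"
      unfolding g_def h_def by (intro sbeta_sign_likelihood \<beta> \<gamma>) (auto simp: I_def)
    \<comment> \<open>The integrals over the coordinates other than \<open>j\<close> are a common
      factor of both sides.\<close>
    then show ?thesis
      unfolding L_def
      by (simp add: integral_prior_prod_times[OF k \<beta> g h]
          integral_prior_prod_times[OF k \<beta> g continuous_on_id] \<gamma>_def[symmetric])
  qed
  have "(\<integral>\<mu>. (\<integral>S. (\<integral>\<theta>. (\<Sum>i=1..n. phi k \<mu> \<theta> (S i)) \<partial>A S) \<partial>measure_pmf (sample_pmf n \<mu> k)) \<partial>prior k \<beta>)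
      = (LINT \<mu>|prior k \<beta>. (\<Sum>S\<in>sample_space n k. \<Sum>j\<in>UNIV. m S $ j / C * (L S \<mu> * h S j (\<mu> $ j))))"
  proof (rule Bochner_Integration.integral_cong[OF refl])
    fix \<mu> :: "real ^ 'd" assume "\<mu> \<in> space (prior k \<beta>)"
    \<comment> \<open>Inside the box \<open>sparse_pmf\<close> really has the intended mass
      function, so the expectation over samples is an explicit finite sum.\<close>
    then have \<mu>: "\<mu> \<in> param_box k" by (simp add: space_prior)
    have "(\<integral>S. (\<integral>\<theta>. (\<Sum>i=1..n. phi k \<mu> \<theta> (S i)) \<partial>A S) \<partial>measure_pmf (sample_pmf n \<mu> k))
        = (\<Sum>S\<in>sample_space n k. (L S \<mu> / C) *\<^sub>R (\<integral>\<theta>. (\<Sum>i=1..n. phi k \<mu> \<theta> (S i)) \<partial>A S))"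
      by (simp only: integral_sample_pmf[OF k \<mu>] L_def g_def I_def \<gamma>_def C_def of_nat_power)
    also have "\<dots> = (\<Sum>S\<in>sample_space n k. (L S \<mu> / C) *\<^sub>R (\<Sum>j\<in>UNIV. m S $ j * h S j (\<mu> $ j)))"
      by (simp only: integral_sum_phi[OF assms(4)] m_def h_def I_def \<gamma>_def cong: sum.cong)
    finally show "(\<integral>S. (\<integral>\<theta>. (\<Sum>i=1..n. phi k \<mu> \<theta> (S i)) \<partial>A S) \<partial>measure_pmf (sample_pmf n \<mu> k))
        = (\<Sum>S\<in>sample_space n k. \<Sum>j\<in>UNIV. m S $ j / C * (L S \<mu> * h S j (\<mu> $ j)))"
      by (simp add: sum_distrib_left mult_ac)
  qed
  \<comment> \<open>Both sums are finite and \<open>m S $ j / C\<close> is constant in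
    \<open>\<mu>\<close>, so only integrals covered by \<open>key\<close> remain.\<close>
  also have "\<dots> = (\<Sum>S\<in>sample_space n k. \<Sum>j\<in>UNIV.
      m S $ j / C * (LINT \<mu>|prior k \<beta>. L S \<mu> * h S j (\<mu> $ j)))"
    using int[OF h] by (simp add: Bochner_Integration.integral_sum)
  also have "\<dots> = 2 * \<beta> / \<gamma> * (\<Sum>S\<in>sample_space n k. \<Sum>j\<in>UNIV.
      m S $ j / C * (LINT \<mu>|prior k \<beta>. L S \<mu> * \<mu> $ j))"
    by (simp add: key sum_distrib_left mult_ac)
  \<comment> \<open>The same exchange in reverse, now with the identity in place of
    \<open>h\<close>.\<close>
  also have "(\<Sum>S\<in>sample_space n k. \<Sum>j\<in>UNIV. m S $ j / C * (LINT \<mu>|prior k \<beta>. L S \<mu> * \<mu> $ j))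
      = (LINT \<mu>|prior k \<beta>. (\<Sum>S\<in>sample_space n k. \<Sum>j\<in>UNIV. m S $ j / C * (L S \<mu> * \<mu> $ j)))"
    using int[OF continuous_on_id] by (simp add: Bochner_Integration.integral_sum)
  also have "\<dots> = (\<integral>\<mu>. \<mu> \<bullet> (\<integral>S. (\<integral>\<theta>. \<theta> \<partial>A S) \<partial>measure_pmf (sample_pmf n \<mu> k)) \<partial>prior k \<beta>)"
  proof (rule Bochner_Integration.integral_cong[OF refl])
    fix \<mu> :: "real ^ 'd" assume "\<mu> \<in> space (prior k \<beta>)"
    then have \<mu>: "\<mu> \<in> param_box k" by (simp add: space_prior)
    have "(\<integral>S. (\<integral>\<theta>. \<theta> \<partial>A S) \<partial>measure_pmf (sample_pmf n \<mu> k))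
        = (\<Sum>S\<in>sample_space n k. (L S \<mu> / C) *\<^sub>R m S)"
      by (simp only: integral_sample_pmf[OF k \<mu>] L_def g_def I_def \<gamma>_def C_def m_def of_nat_power)
    then show "(\<Sum>S\<in>sample_space n k. \<Sum>j\<in>UNIV. m S $ j / C * (L S \<mu> * \<mu> $ j))
        = \<mu> \<bullet> (\<integral>S. (\<integral>\<theta>. \<theta> \<partial>A S) \<partial>measure_pmf (sample_pmf n \<mu> k))"
      by (simp add: inner_sum_right inner_vec_def[of \<mu>] sum_distrib_left mult_ac)
  qed
  finally show ?thesis by (simp add: \<gamma>_def)
qed

end
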